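(* As formal power series in $t$ (with coefficients rational functions of $z$), \[ e^{t+z\frac{t^2}{2}} = \sum_{n=0}^\infty t^n \sum_{\lambda\vdash n}\prod_{x\in\lambda} \rho(h(x),z), \qquad\text{where}\qquad \rho(n,z) = \frac{\displaystyle\sum_{k \geq 0} \binom{n}{2k} z^k}{\displaystyle n \sum_{k \geq 0} \binom{n}{2k+1} z^k}. \]
   Context: The inner sum runs over all integer partitions $\lambda$ of $n$ (for $n=0$ only the empty partition, whose empty product is $1$). Each partition is identified with its Young diagram, $x\in\lambda$ ranges over its cells, and $h(x)$ denotes the hook length of the cell $x$ (the number of cells directly to its right in the same row, plus the number directly below it in the same column, plus one). *)

theory Defs
  imports "HOL-Computational_Algebra.Computational_Algebra"
begin

text \<open>
  The field of rational functions in one indeterminate over a field \<open>'a\<close> is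
  \<open>'a poly fract\<close>. The exponential series \<open>fps_exp\<close> needs coefficients in a
  field of characteristic 0.
\<close>

instance fract :: ("{idom, ring_char_0}") field_char_0
proof
  have of_nat_fract: "(of_nat n :: 'a fract) = Fraction_Field.Fract (of_nat n) 1" for n
    by (induction n) (simp_all add: Zero_fract_def One_fract_def)
  show "inj (of_nat :: nat \<Rightarrow> 'a fract)"
    by (rule injI) (simp add: of_nat_fract eq_fract)
qed

definition indet :: "'a::idom poly fract" where
  "indet = Fraction_Field.Fract [:0, 1:] 1"

text \<open>Partitions are the weakly decreasing lists of their (positive) parts.\<close>

definition partitions :: "nat \<Rightarrow> nat list set" where
  "partitions n = {l. sorted_wrt (\<ge>) l \<and> 0 \<notin> set l \<and> sum_list l = n}"

text \<open>Cells are pairs (row, column), both counted from 0.\<close>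

definition young_diagram :: "nat list \<Rightarrow> (nat \<times> nat) set" where
  "young_diagram l = {(i, j). i < length l \<and> j < l ! i}"

definition hook_length :: "nat list \<Rightarrow> nat \<times> nat \<Rightarrow> nat" where
  "hook_length l = (\<lambda>(i, j).
     card {j'. j < j' \<and> (i, j') \<in> young_diagram l} +
     card {i'. i < i' \<and> (i', j) \<in> young_diagram l} + 1)"

text \<open>
  The binomial coefficients vanish for \<open>k > n\<close>, so the sums over all \<open>k \<ge> 0\<close> are
  cut off at \<open>k = n\<close>. Only \<open>n \<ge> 1\<close> is meaningful (hook lengths are positive).
\<close>

definition rho :: "nat \<Rightarrow> 'a::field \<Rightarrow> 'a" where
  "rho n z = (\<Sum>k\<le>n. of_nat (n choose (2 * k)) * z ^ k) /
     (of_nat n * (\<Sum>k\<le>n. of_nat (n choose (2 * k + 1)) * z ^ k))"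

text \<open>The sums and products over these sets are genuinely finite.\<close>

lemma finite_partitions: "finite (partitions n)"
proof (rule finite_subset)
  have "length l \<le> sum_list l" if "0 \<notin> set l" for l :: "nat list"
    using that by (induction l) auto
  then show "partitions n \<subseteq> {l. set l \<subseteq> {..n} \<and> length l \<le> n}"
    by (auto simp: partitions_def intro: member_le_sum_list)
  show "finite {l. set l \<subseteq> {..n} \<and> length l \<le> n}"
    by (rule finite_lists_length_le) simp
qed

lemma finite_young_diagram: "finite (young_diagram l)"
proof -
  have "young_diagram l = (SIGMA i : {..<length l}. {..<l ! i})"
    by (auto simp: young_diagram_def)
  then show ?thesis by simp
qed

end

theory Submission
  imports Defs
begin

text \<open>
  Since \<open>\<rho>(h, z) = \<phi>(h) / h\<close> for a hyperbolic cotangent \<open>\<phi>\<close>, the summand of \<open>\<lambda>\<close> is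
  \<open>H(\<lambda>) P(\<lambda>)\<close> with \<open>H\<close> and \<open>P\<close> the products of \<open>1 / h\<close> and of \<open>\<phi>(h)\<close> over the hook lengths.
  Writing \<open>\<lambda>\<^sup>+\<close> and \<open>\<lambda>\<^sup>-\<close> for the partitions that arise by adding and by deleting a cell, one has
  \<open>\<Sum>H(\<lambda>\<^sup>-) = n H(\<lambda>)\<close>, \<open>\<Sum>H(\<lambda>\<^sup>+) = H(\<lambda>)\<close> and \<open>\<Sum>P(\<lambda>\<^sup>+) = P(\<lambda>) + z \<Sum>P(\<lambda>\<^sup>-)\<close>, where
  \<open>n\<close> is the size of \<open>\<lambda>\<close>. Double counting then gives \<open>n a(n) = a(n - 1) + z a(n - 2)\<close> for
  \<open>a(n) = \<Sum>H(\<lambda>) P(\<lambda>)\<close>, the recurrence of the coefficients of \<open>exp(t + z t\<^sup>2 / 2)\<close>.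

  The three local identities are read off beta-sets (first column hook lengths, zero rows allowed):
  there a product over hooks is a product over elements and pairs of elements, adding a cell
  increments an element, and the identities become partial fraction expansions.
\<close>

section \<open>Partial fraction identities\<close>

text \<open>As a function of \<open>t\<close> the product has simple poles at the distinct points
  \<open>f i\<close> and the value of the product of the \<open>p i\<close> at infinity. Induction
  replaces the limit argument and works over any field.\<close>

lemma prod_partial_fractions:
  fixes f :: "'i \<Rightarrow> 'a::field"
  assumes "finite I" "inj_on f I" "t \<notin> f ` I"
  shows "(\<Prod>i\<in>I. p i + r i / (t - f i)) =
    (\<Prod>i\<in>I. p i) + (\<Sum>i\<in>I. r i * (\<Prod>j\<in>I - {i}. p j + r j / (f i - f j)) / (t - f i))"
  using assms
proof (induction I arbitrary: t rule: finite_induct)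
  case empty
  then show ?case by simp
next
  case (insert x I)
  define R where "R i = (\<Prod>j\<in>I - {i}. p j + r j / (f i - f j))" for i
  have fx: "f x \<notin> f ` I" and inj: "inj_on f I"
    using insert.prems insert.hyps by auto
  have t: "t \<notin> f ` I" "t \<noteq> f x"
    using insert.prems by auto
  have R: "(\<Prod>j\<in>insert x I - {i}. p j + r j / (f i - f j)) = (p x + r x / (f i - f x)) * R i"
    if "i \<in> I" for i
  proof -
    have "insert x I - {i} = insert x (I - {i})"
      using that insert.hyps by auto
    then show ?thesis
      using insert.hyps by (simp add: R_def)
  qed
  \<comment> \<open>The residue at the new pole is the induction hypothesis taken at
    \<open>t = f x\<close>; hence \<open>t\<close> is generalized.\<close>
  have Rx: "(\<Prod>j\<in>insert x I - {x}. p j + r j / (f x - f j)) = (\<Prod>i\<in>I. p i) + (\<Sum>i\<in>I. r i * R i / (f x - f i))"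
    using insert.IH[OF inj fx] insert.hyps by (simp add: R_def)
  have step: "(p x + r x / (t - f x)) * (r i * R i / (t - f i)) =
      r i * ((p x + r x / (f i - f x)) * R i) / (t - f i) + r x * (r i * R i / (f x - f i)) / (t - f x)"
    if "i \<in> I" for i
  proof -
    have ne: "t - f i \<noteq> 0" "t - f x \<noteq> 0" "f i - f x \<noteq> 0" "f x - f i \<noteq> 0"
      using that t fx by (auto simp: image_iff)
    have "1 / (t - f x) / (t - f i) = 1 / (f i - f x) / (t - f i) + 1 / (f x - f i) / (t - f x)"
    proof -
      have "1 / (f x - f i) = - (1 / (f i - f x))"
        by (metis minus_diff_eq minus_divide_right)
      moreover have "1 / (t - f x) / (t - f i) = 1 / (f i - f x) / (t - f i) - 1 / (f i - f x) / (t - f x)"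
        using ne by (simp add: divide_simps)
      ultimately show ?thesis by simp
    qed
    then have "p x * r i * R i / (t - f i) + r x * r i * R i * (1 / (t - f x) / (t - f i)) =
      p x * r i * R i / (t - f i) + r x * r i * R i * (1 / (f i - f x) / (t - f i) + 1 / (f x - f i) / (t - f x))"
      by simp
    then show ?thesis
      by (simp add: algebra_simps add_divide_distrib)
  qed
  have "(\<Prod>i\<in>insert x I. p i + r i / (t - f i)) =
    (p x + r x / (t - f x)) * ((\<Prod>i\<in>I. p i) + (\<Sum>i\<in>I. r i * R i / (t - f i)))"
    using insert.IH[OF inj t(1)] insert.hyps by (simp add: R_def)
  also have "\<dots> = p x * (\<Prod>i\<in>I. p i) +
     (r x * ((\<Prod>i\<in>I. p i) + (\<Sum>i\<in>I. r i * R i / (f x - f i))) / (t - f x) +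
      (\<Sum>i\<in>I. r i * ((p x + r x / (f i - f x)) * R i) / (t - f i)))"
  proof -
    have "(p x + r x / (t - f x)) * (\<Sum>i\<in>I. r i * R i / (t - f i)) =
      (\<Sum>i\<in>I. r i * ((p x + r x / (f i - f x)) * R i) / (t - f i)) +
      r x * (\<Sum>i\<in>I. r i * R i / (f x - f i)) / (t - f x)"
      using step by (simp add: sum_distrib_left sum_divide_distrib sum.distrib)
    then show ?thesis
      by (simp add: distrib_left distrib_right add_divide_distrib)
  qed
  also have "\<dots> = (\<Prod>i\<in>insert x I. p i) +
      (\<Sum>i\<in>insert x I. r i * (\<Prod>j\<in>insert x I - {i}. p j + r j / (f i - f j)) / (t - f i))"
    using insert.hyps Rx R by simp
  finally show ?case .
qed

text \<open>Morally, these are the coefficients of \<open>1/t\<close> and \<open>1/t^2\<close> at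
  infinity of the product of the \<open>1 - 1/(t - f j)\<close>; the triangular number counts pairs.
  The proof inserts one point at a time, and the second sum needs the first.\<close>

lemma sum_residues_shift:
  fixes f :: "'i \<Rightarrow> 'a::field"
  assumes "finite I" "inj_on f I"
  shows "(\<Sum>i\<in>I. \<Prod>j\<in>I - {i}. 1 - 1 / (f i - f j)) = of_nat (card I)"
    and "(\<Sum>i\<in>I. f i * (\<Prod>j\<in>I - {i}. 1 - 1 / (f i - f j))) =
      (\<Sum>i\<in>I. f i) - of_nat (\<Sum>{..<card I})"
proof -
  have "(\<Sum>i\<in>I. \<Prod>j\<in>I - {i}. 1 - 1 / (f i - f j)) = of_nat (card I) \<and>
    (\<Sum>i\<in>I. f i * (\<Prod>j\<in>I - {i}. 1 - 1 / (f i - f j))) =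
      (\<Sum>i\<in>I. f i) - of_nat (\<Sum>{..<card I})"
    using assms
  proof (induction I rule: finite_induct)
    case empty
    then show ?case by simp
  next
    case (insert x I)
    define R where "R i = (\<Prod>j\<in>I - {i}. 1 - 1 / (f i - f j))" for i
    have fx: "f x \<notin> f ` I" and inj: "inj_on f I"
      using insert.prems insert.hyps by auto
    have ne: "f i \<noteq> f x" if "i \<in> I" for i
      using fx that by (metis image_eqI)
    have R: "(\<Prod>j\<in>insert x I - {i}. 1 - 1 / (f i - f j)) = R i + R i / (f x - f i)"
      if "i \<in> I" for i
    proof -
      have "insert x I - {i} = insert x (I - {i})"
        using that insert.hyps by auto
      then show ?thesis
        using insert.hyps ne[OF that] by (simp add: R_def divide_simps) (simp add: algebra_simps)
    qed
    have Rx: "(\<Prod>j\<in>insert x I - {x}. 1 - 1 / (f x - f j)) = 1 - (\<Sum>i\<in>I. R i / (f x - f i))"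
      using prod_partial_fractions[OF insert.hyps(1) inj fx, of "\<lambda>_. 1" "\<lambda>_. - 1"] insert.hyps
      by (simp add: R_def sum_negf)
    have IH: "(\<Sum>i\<in>I. R i) = of_nat (card I)"
      "(\<Sum>i\<in>I. f i * R i) = (\<Sum>i\<in>I. f i) - of_nat (\<Sum>{..<card I})"
      using insert.IH[OF inj] by (simp_all add: R_def)
    \<comment> \<open>Writing \<open>f i = f x - (f x - f i)\<close> splits off the sum of the
      \<open>R i\<close>; the part with factor \<open>f x\<close> later cancels against the term of
      \<open>x\<close>.\<close>
    have "(\<Sum>i\<in>I. f i * (R i + R i / (f x - f i))) = (\<Sum>i\<in>I. f i * R i + f x * (R i / (f x - f i)) - R i)"
      using ne by (intro sum.cong refl) (auto simp: divide_simps, auto simp: algebra_simps)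
    also have "\<dots> = (\<Sum>i\<in>I. f i * R i) + f x * (\<Sum>i\<in>I. R i / (f x - f i)) - (\<Sum>i\<in>I. R i)"
      by (simp add: sum.distrib sum_subtractf sum_distrib_left)
    finally have S: "(\<Sum>i\<in>I. f i * (R i + R i / (f x - f i))) = \<dots>" .
    have "(\<Sum>i\<in>insert x I. \<Prod>j\<in>insert x I - {i}. 1 - 1 / (f i - f j)) =
      1 - (\<Sum>i\<in>I. R i / (f x - f i)) + (\<Sum>i\<in>I. R i + R i / (f x - f i))"
      using insert.hyps Rx R by simp
    also have "\<dots> = of_nat (card (insert x I))"
      using insert.hyps IH by (simp add: sum.distrib)
    finally have 1: "(\<Sum>i\<in>insert x I. \<Prod>j\<in>insert x I - {i}. 1 - 1 / (f i - f j)) = of_nat (card (insert x I))" .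
    have "(\<Sum>i\<in>insert x I. f i * (\<Prod>j\<in>insert x I - {i}. 1 - 1 / (f i - f j))) =
      f x * (1 - (\<Sum>i\<in>I. R i / (f x - f i))) + (\<Sum>i\<in>I. f i * (R i + R i / (f x - f i)))"
      using insert.hyps Rx R by simp
    also have "\<dots> = (\<Sum>i\<in>insert x I. f i) - of_nat (\<Sum>{..<card (insert x I)})"
      unfolding S IH using insert.hyps by (simp add: right_diff_distrib)
    finally show ?case using 1 by blast
  qed
  then show "(\<Sum>i\<in>I. \<Prod>j\<in>I - {i}. 1 - 1 / (f i - f j)) = of_nat (card I)"
    and "(\<Sum>i\<in>I. f i * (\<Prod>j\<in>I - {i}. 1 - 1 / (f i - f j))) =
      (\<Sum>i\<in>I. f i) - of_nat (\<Sum>{..<card I})"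
    by blast+
qed

lemma sum_prod_coth_difference:
  fixes f :: "'i \<Rightarrow> 'a::field"
  assumes "finite I" "inj_on f I"
  shows "(\<Sum>i\<in>I. \<Prod>j\<in>I - {i}. (z - f i * f j) / (f i - f j)) =
    (if odd (card I) then z ^ (card I div 2) else 0)"
proof -
  \<comment> \<open>The second conjunct closes the induction: inserting a point turns the first left
    side into the second one of the old set, and the second into \<open>z\<close> times the first
    one of the old set.\<close>
  have "(\<Sum>i\<in>I. \<Prod>j\<in>I - {i}. (z - f i * f j) / (f i - f j)) =
      (if odd (card I) then z ^ (card I div 2) else 0) \<and>
    (\<Prod>i\<in>I. - f i) + (\<Sum>i\<in>I. f i * (\<Prod>j\<in>I - {i}. (z - f i * f j) / (f i - f j))) =
      (if even (card I) then z ^ (card I div 2) else 0)"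
    using assms
  proof (induction I rule: finite_induct)
    case empty
    then show ?case by simp
  next
    case (insert x I)
    define T where "T i = (\<Prod>j\<in>I - {i}. (z - f i * f j) / (f i - f j))" for i
    have fx: "f x \<notin> f ` I" and inj: "inj_on f I"
      using insert.prems insert.hyps by auto
    have ne: "f i \<noteq> f x" if "i \<in> I" for i
      using fx that by (metis image_eqI)
    \<comment> \<open>Splits a factor, as a function of \<open>s\<close>, into its value at infinity
      and its pole.\<close>
    have coth: "(z - s * f j) / (s - f j) = - f j + (z - f j * f j) / (s - f j)" if "s \<noteq> f j" for s j
      using that by (simp add: divide_simps) (simp add: algebra_simps)
    have T: "(\<Prod>j\<in>insert x I - {i}. (z - f i * f j) / (f i - f j)) = (z - f i * f x) / (f i - f x) * T i"
      if "i \<in> I" for i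
    proof -
      have "insert x I - {i} = insert x (I - {i})"
        using that insert.hyps by auto
      then show ?thesis
        using insert.hyps by (simp add: T_def)
    qed
    have T_alt: "T i = (\<Prod>j\<in>I - {i}. - f j + (z - f j * f j) / (f i - f j))" if "i \<in> I" for i
      unfolding T_def using that inj by (intro prod.cong refl coth) (auto dest: inj_onD)
    have "(\<Prod>j\<in>I. (z - f x * f j) / (f x - f j)) = (\<Prod>j\<in>I. - f j + (z - f j * f j) / (f x - f j))"
      by (intro prod.cong refl coth) (metis ne)
    also have "\<dots> = (\<Prod>i\<in>I. - f i) + (\<Sum>i\<in>I. (z - f i * f i) * T i / (f x - f i))"
      using prod_partial_fractions[OF insert.hyps(1) inj fx, of "\<lambda>j. - f j" "\<lambda>j. z - f j * f j"] T_alt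
      by simp
    finally have Tx: "(\<Prod>j\<in>insert x I - {x}. (z - f x * f j) / (f x - f j)) = \<dots>"
      using insert.hyps by simp
    have 1: "(z - f i * f i) * T i / (f x - f i) + (z - f i * f x) / (f i - f x) * T i = f i * T i"
      if "i \<in> I" for i
    proof -
      have "(z - f i * f x) / (f i - f x) = - (z - f i * f x) / (f x - f i)"
        by (metis minus_diff_eq minus_divide_divide)
      then show ?thesis
        using ne[OF that] by (simp add: divide_simps) (simp add: algebra_simps)
    qed
    have 2: "f x * ((z - f i * f i) * T i / (f x - f i)) + f i * ((z - f i * f x) / (f i - f x) * T i) = z * T i"
      if "i \<in> I" for i
    proof -
      have "(z - f i * f x) / (f i - f x) = - (z - f i * f x) / (f x - f i)"
        by (metis minus_diff_eq minus_divide_divide)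
      then show ?thesis
        using ne[OF that] by (simp add: divide_simps) (simp add: algebra_simps)
    qed
    have "(\<Sum>i\<in>insert x I. \<Prod>j\<in>insert x I - {i}. (z - f i * f j) / (f i - f j)) =
      (\<Prod>i\<in>I. - f i) + (\<Sum>i\<in>I. (z - f i * f i) * T i / (f x - f i) + (z - f i * f x) / (f i - f x) * T i)"
      using insert.hyps Tx T by (simp add: sum.distrib)
    also have "\<dots> = (\<Prod>i\<in>I. - f i) + (\<Sum>i\<in>I. f i * T i)"
      using 1 by simp
    finally have E: "(\<Sum>i\<in>insert x I. \<Prod>j\<in>insert x I - {i}. (z - f i * f j) / (f i - f j)) = \<dots>" .
    have "(\<Prod>i\<in>insert x I. - f i) +
        (\<Sum>i\<in>insert x I. f i * (\<Prod>j\<in>insert x I - {i}. (z - f i * f j) / (f i - f j))) =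
      (\<Sum>i\<in>I. f x * ((z - f i * f i) * T i / (f x - f i)) + f i * ((z - f i * f x) / (f i - f x) * T i))"
      using insert.hyps Tx T by (simp add: sum.distrib distrib_left sum_distrib_left)
    also have "\<dots> = z * (\<Sum>i\<in>I. T i)"
      using 2 by (simp add: sum_distrib_left)
    finally have G: "(\<Prod>i\<in>insert x I. - f i) +
        (\<Sum>i\<in>insert x I. f i * (\<Prod>j\<in>insert x I - {i}. (z - f i * f j) / (f i - f j))) = \<dots>" .
    show ?case
      using insert.IH[OF inj] insert.hyps unfolding E G
      by (auto simp: T_def elim!: evenE oddE)
  qed
  then show ?thesis by blast
qed

section \<open>Hook lengths and beta-sets\<close>

fun beta_set :: "nat list \<Rightarrow> nat set" where
  "beta_set [] = {}"
| "beta_set (p # l) = insert (p + length l) (beta_set l)"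

text \<open>One of the truncated differences is 0, so this is the distance.\<close>

definition gap :: "nat \<Rightarrow> nat \<Rightarrow> nat" where
  "gap a b = (a - b) + (b - a)"

text \<open>For \<open>\<phi> h = 1 / h\<close> this is Frobenius' formula: differences of elements
  over their factorials.\<close>

definition beta_weight :: "(nat \<Rightarrow> 'a::field) \<Rightarrow> nat set \<Rightarrow> 'a" where
  "beta_weight \<phi> B = (\<Prod>b\<in>B. \<Prod>d=1..b. \<phi> d) / (\<Prod>a\<in>B. \<Prod>b\<in>{b\<in>B. b < a}. \<phi> (a - b))"

text \<open>The empty partition padded to \<open>k\<close> zero rows has beta-set
  \<open>{..<k}\<close>, so \<open>n\<close> is the excess over its sum.\<close>

definition beta_sets :: "nat \<Rightarrow> nat \<Rightarrow> nat set set" where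
  "beta_sets k n = {B. finite B \<and> card B = k \<and> \<Sum>B = n + \<Sum>{..<k}}"

text \<open>The new pairs join \<open>b\<close> to elements on either side of it; \<open>gap\<close>
  covers both, so \<open>b\<close> may be inserted at any position.\<close>

lemma beta_weight_insert:
  assumes "finite C" "b \<notin> C"
  shows "beta_weight \<phi> (insert b C) = beta_weight \<phi> C * (\<Prod>d=1..b. \<phi> d) / (\<Prod>a\<in>C. \<phi> (gap a b))"
proof -
  have "(\<Prod>x\<in>C. \<Prod>y\<in>{y\<in>insert b C. y < x}. \<phi> (x - y)) =
    (\<Prod>x\<in>C. (if b < x then \<phi> (x - b) else 1) * (\<Prod>y\<in>{y\<in>C. y < x}. \<phi> (x - y)))"
  proof (intro prod.cong refl)
    fix x assume "x \<in> C"
    show "(\<Prod>y\<in>{y\<in>insert b C. y < x}. \<phi> (x - y)) =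
        (if b < x then \<phi> (x - b) else 1) * (\<Prod>y\<in>{y\<in>C. y < x}. \<phi> (x - y))"
    proof (cases "b < x")
      case True
      then have "{y\<in>insert b C. y < x} = insert b {y\<in>C. y < x}" by auto
      then show ?thesis using assms True by simp
    next
      case False
      then have "{y\<in>insert b C. y < x} = {y\<in>C. y < x}" by auto
      then show ?thesis using False by simp
    qed
  qed
  moreover have "{y\<in>insert b C. y < b} = {y\<in>C. y < b}" by auto
  moreover have "(\<Prod>y\<in>{y\<in>C. y < b}. \<phi> (b - y)) * (\<Prod>x\<in>C. if b < x then \<phi> (x - b) else 1) =
    (\<Prod>a\<in>C. \<phi> (gap a b))"
  proof -
    have "(\<Prod>y\<in>{y\<in>C. y < b}. \<phi> (b - y)) = (\<Prod>y\<in>C. if y < b then \<phi> (b - y) else 1)"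
      using assms(1) by (rule prod.inter_filter)
    then show ?thesis
      using assms(2) by (auto simp: gap_def simp flip: prod.distrib intro!: prod.cong)
  qed
  ultimately have "(\<Prod>x\<in>insert b C. \<Prod>y\<in>{y\<in>insert b C. y < x}. \<phi> (x - y)) =
    (\<Prod>a\<in>C. \<phi> (gap a b)) * (\<Prod>x\<in>C. \<Prod>y\<in>{y\<in>C. y < x}. \<phi> (x - y))"
    using assms by (simp add: prod.distrib flip: mult.assoc)
  then show ?thesis
    using assms by (simp add: beta_weight_def mult.commute)
qed

section \<open>Beta-sets of weakly decreasing lists\<close>

lemma finite_beta_set [simp]: "finite (beta_set l)"
  by (induction l) auto

lemma beta_set_less:
  assumes "sorted_wrt (\<ge>) (p # l)" "b \<in> beta_set l"
  shows "b < p + length l"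
  using assms by (induction l) force+

lemma card_beta_set:
  assumes "sorted_wrt (\<ge>) l"
  shows "card (beta_set l) = length l"
  using assms
proof (induction l)
  case (Cons p l)
  have "p + length l \<notin> beta_set l"
    using beta_set_less[OF Cons.prems] by blast
  then show ?case using Cons by simp
qed simp

lemma sum_beta_set:
  assumes "sorted_wrt (\<ge>) l"
  shows "\<Sum>(beta_set l) = sum_list l + \<Sum>{..<length l}"
  using assms
proof (induction l)
  case (Cons p l)
  have "p + length l \<notin> beta_set l"
    using beta_set_less[OF Cons.prems] by blast
  then show ?case using Cons by simp
qed simp

text \<open>The maximum belongs to the first row and, with the length known, determines it.\<close>

lemma beta_set_inject:
  assumes "sorted_wrt (\<ge>) l" "sorted_wrt (\<ge>) l'" "length l = length l'" "beta_set l = beta_set l'"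
  shows "l = l'"
  using assms
proof (induction l arbitrary: l')
  case Nil
  then show ?case by simp
next
  case (Cons p l)
  then obtain q m where l': "l' = q # m" by (cases l') auto
  have less: "b < p + length l" if "b \<in> beta_set l" for b
    using Cons.prems(1) that by (rule beta_set_less)
  have less': "b < q + length m" if "b \<in> beta_set m" for b
    using Cons.prems(2)[unfolded l'] that by (rule beta_set_less)
  have eq: "insert (p + length l) (beta_set l) = insert (q + length m) (beta_set m)"
    using Cons.prems(4) l' by simp
  \<comment> \<open>Otherwise each head would lie in the other tail and be smaller than the other
    head.\<close>
  have pq: "p + length l = q + length m"
  proof (rule ccontr)
    assume "p + length l \<noteq> q + length m"
    then have "p + length l \<in> beta_set m" "q + length m \<in> beta_set l"
      using eq by (metis insert_iff)+
    then show False
      using less less' by (metis less_asym)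
  qed
  have "p + length l \<notin> beta_set l" "p + length l \<notin> beta_set m"
    using less less' pq by (metis less_irrefl)+
  then have "beta_set l = beta_set m"
    using eq unfolding pq [symmetric] by (metis insert_ident)
  moreover have "sorted_wrt (\<ge>) l" "sorted_wrt (\<ge>) m" "length l = length m"
    using Cons.prems(1-3) l' by auto
  ultimately have "l = m"
    by (intro Cons.IH)
  then show ?case using pq l' by simp
qed

text \<open>Without its maximum \<open>M\<close> the set comes from the lower rows \<open>l\<close>,
  and a first row of length \<open>M - length l\<close> restores \<open>M\<close>.\<close>

lemma beta_set_surj:
  assumes "finite B"
  shows "\<exists>l. sorted_wrt (\<ge>) l \<and> beta_set l = B"
  using assms
proof (induction B rule: finite_linorder_max_induct)
  case empty
  then show ?case by (intro exI[of _ "[]"]) simp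
next
  case (insert M B)
  then obtain l where l: "sorted_wrt (\<ge>) l" "beta_set l = B" by auto
  \<comment> \<open>At most \<open>M\<close> naturals lie below \<open>M\<close>, so the truncated
    \<open>M - length l\<close> is exact.\<close>
  have "B \<subseteq> {..<M}" using insert.hyps by auto
  then have len: "length l \<le> M"
    using card_mono[of "{..<M}" B] card_beta_set[OF l(1)] l(2) by simp
  have "q \<le> M - length l" if "q \<in> set l" for q
  proof -
    from that obtain r m where m: "l = r # m" by (cases l) auto
    then have "r + length m < M" using l(2) insert.hyps by auto
    moreover have "q \<le> r" using that m l(1) by auto
    ultimately show ?thesis using m by simp
  qed
  then show ?case
    using l len by (intro exI[of _ "(M - length l) # l"]) auto
qed

section \<open>Hook products row by row\<close>

lemma prod_diff_reindex:
  fixes m p :: nat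
  assumes "m \<le> p"
  shows "(\<Prod>j=m..<p. \<phi> (p - j)) = (\<Prod>d=1..p - m. \<phi> d)"
  by (rule prod.reindex_bij_witness[of _ "\<lambda>d. p - d" "\<lambda>j. p - j"]) (use assms in auto)

text \<open>
  Prepending a row of length \<open>m\<close> below a row of length \<open>p\<close> amounts to lengthening the latter by
  one and deleting the hook length \<open>p + 1 - m\<close>: both products agree on the first \<open>m\<close> columns.
\<close>

lemma prod_row_hooks:
  fixes \<phi> :: "nat \<Rightarrow> 'a::field"
  assumes "\<And>h. h > 0 \<Longrightarrow> \<phi> h \<noteq> 0"
    and "sorted_wrt (\<ge>) l" "\<And>q. q \<in> set l \<Longrightarrow> q \<le> p"
  shows "(\<Prod>j<p. \<phi> (p - j + length (filter (\<lambda>q. j < q) l))) =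
    (\<Prod>d=1..p + length l. \<phi> d) / (\<Prod>b\<in>beta_set l. \<phi> (p + length l - b))"
  using assms(2,3)
proof (induction l arbitrary: p)
  case Nil
  then show ?case
    using prod_diff_reindex[of 0 p \<phi>] by (simp add: atLeast0LessThan)
next
  case (Cons m l)
  have m: "m \<le> p" and le: "\<And>q. q \<in> set l \<Longrightarrow> q \<le> m"
    using Cons.prems by auto
  define c where "c j = length (filter (\<lambda>q. j < q) l)" for j
  have c0: "c j = 0" if "m \<le> j" for j
    using le that by (auto simp: c_def filter_empty_conv) force
  have split: "(\<Prod>j<r. g j) = (\<Prod>j<m. g j) * (\<Prod>j=m..<r. g j)" if "m \<le> r" for r and g :: "nat \<Rightarrow> 'a"
    using prod.atLeastLessThan_concat[of 0 m r g] that by (simp add: lessThan_atLeast0)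
  have X: "(\<Prod>j<p. \<phi> (p - j + length (filter (\<lambda>q. j < q) (m # l)))) =
    (\<Prod>j<m. \<phi> (Suc p - j + c j)) * (\<Prod>j=m..<p. \<phi> (p - j))"
  proof -
    \<comment> \<open>In the first \<open>m\<close> columns the row \<open>m\<close> lengthens each
      leg by one, just as a cell added to the row \<open>p\<close> lengthens each arm.\<close>
    have "(\<Prod>j<m. \<phi> (p - j + length (filter (\<lambda>q. j < q) (m # l)))) = (\<Prod>j<m. \<phi> (Suc p - j + c j))"
      using m by (intro prod.cong) (auto simp: c_def Suc_diff_le)
    moreover have "(\<Prod>j=m..<p. \<phi> (p - j + length (filter (\<lambda>q. j < q) (m # l)))) = (\<Prod>j=m..<p. \<phi> (p - j))"
      using c0 by (intro prod.cong) (auto simp: c_def)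
    ultimately show ?thesis
      using split[OF m] by (simp only:)
  qed
  have Y: "(\<Prod>j<Suc p. \<phi> (Suc p - j + c j)) =
    (\<Prod>j<m. \<phi> (Suc p - j + c j)) * (\<Prod>j=m..<Suc p. \<phi> (Suc p - j))"
  proof -
    have "(\<Prod>j=m..<Suc p. \<phi> (Suc p - j + c j)) = (\<Prod>j=m..<Suc p. \<phi> (Suc p - j))"
      using c0 by (intro prod.cong) auto
    then show ?thesis
      by (simp only: split[OF le_SucI[OF m]])
  qed
  \<comment> \<open>From column \<open>m\<close> on the hooks of the lengthened row are 1 to
    \<open>Suc p - m\<close>; only the largest is new.\<close>
  have Z: "(\<Prod>j=m..<Suc p. \<phi> (Suc p - j)) = (\<Prod>j=m..<p. \<phi> (p - j)) * \<phi> (Suc p - m)"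
    using m prod_diff_reindex[of m p \<phi>] prod_diff_reindex[of m "Suc p" \<phi>] by (simp add: Suc_diff_le)
  have "\<phi> (Suc p - m) \<noteq> 0"
    using m by (intro assms(1)) simp
  then have "(\<Prod>j<p. \<phi> (p - j + length (filter (\<lambda>q. j < q) (m # l)))) =
    (\<Prod>j<Suc p. \<phi> (Suc p - j + c j)) / \<phi> (Suc p - m)"
    unfolding X Y Z by simp
  also have "(\<Prod>j<Suc p. \<phi> (Suc p - j + c j)) =
    (\<Prod>d=1..Suc p + length l. \<phi> d) / (\<Prod>b\<in>beta_set l. \<phi> (Suc p + length l - b))"
    unfolding c_def using Cons.prems by (intro Cons.IH) (auto intro: le_SucI)
  also have "\<dots> / \<phi> (Suc p - m) =
    (\<Prod>d=1..p + length (m # l). \<phi> d) / (\<Prod>b\<in>beta_set (m # l). \<phi> (p + length (m # l) - b))"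
  proof -
    have "m + length l \<notin> beta_set l"
      using beta_set_less[OF Cons.prems(1)] by blast
    then show ?thesis by (simp add: divide_divide_eq_left' mult.commute [of "prod _ _"])
  qed
  finally show ?case .
qed

lemma young_diagram_Cons:
  "young_diagram (p # l) = Pair 0 ` {..<p} \<union> map_prod Suc id ` young_diagram l"
proof -
  have "(i, j) \<in> young_diagram (p # l) \<longleftrightarrow> (i, j) \<in> Pair 0 ` {..<p} \<union> map_prod Suc id ` young_diagram l"
    for i j
    by (cases i) (auto simp: young_diagram_def image_iff)
  then show ?thesis by auto
qed

lemma hook_length_Cons_Suc: "hook_length (p # l) (Suc i, j) = hook_length l (i, j)"
proof -
  have "{i'. Suc i < i' \<and> (i', j) \<in> young_diagram (p # l)} =
    Suc ` {i'. i < i' \<and> (i', j) \<in> young_diagram l}"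
    by (auto simp: young_diagram_def image_iff Suc_less_eq2)
  then show ?thesis
    by (simp add: hook_length_def card_image) (simp add: young_diagram_def)
qed

lemma hook_length_Cons_0:
  assumes "j < p"
  shows "hook_length (p # l) (0, j) = p - j + length (filter (\<lambda>q. j < q) l)"
proof -
  have "{i'. 0 < i' \<and> (i', j) \<in> young_diagram (p # l)} = Suc ` {i. i < length l \<and> j < l ! i}"
    by (auto simp: young_diagram_def image_iff gr0_conv_Suc)
  moreover have "{j'. j < j' \<and> (0, j') \<in> young_diagram (p # l)} = {j<..<p}"
    by (auto simp: young_diagram_def)
  ultimately show ?thesis
    using assms by (simp add: hook_length_def card_image length_filter_conv_card)
qed

text \<open>The hooks of the first row contribute exactly the factor that
  \<open>beta_weight_insert\<close> assigns to its element, the maximum.\<close>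

lemma prod_hook_length_eq_beta_weight:
  fixes \<phi> :: "nat \<Rightarrow> 'a::field"
  assumes "\<And>h. h > 0 \<Longrightarrow> \<phi> h \<noteq> 0" "sorted_wrt (\<ge>) l"
  shows "(\<Prod>x\<in>young_diagram l. \<phi> (hook_length l x)) = beta_weight \<phi> (beta_set l)"
  using assms(2)
proof (induction l)
  case Nil
  then show ?case by (simp add: young_diagram_def beta_weight_def)
next
  case (Cons p l)
  have less: "b < p + length l" if "b \<in> beta_set l" for b
    using Cons.prems that by (rule beta_set_less)
  have "(\<Prod>x\<in>young_diagram (p # l). \<phi> (hook_length (p # l) x)) =
    (\<Prod>x\<in>Pair 0 ` {..<p}. \<phi> (hook_length (p # l) x)) *
    (\<Prod>x\<in>map_prod Suc id ` young_diagram l. \<phi> (hook_length (p # l) x))"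
    unfolding young_diagram_Cons by (intro prod.union_disjoint) (auto simp: finite_young_diagram)
  also have "(\<Prod>x\<in>Pair 0 ` {..<p}. \<phi> (hook_length (p # l) x)) =
    (\<Prod>j<p. \<phi> (p - j + length (filter (\<lambda>q. j < q) l)))"
    by (subst prod.reindex) (auto simp: inj_on_def hook_length_Cons_0)
  also have "\<dots> = (\<Prod>d=1..p + length l. \<phi> d) / (\<Prod>b\<in>beta_set l. \<phi> (p + length l - b))"
    using Cons.prems by (intro prod_row_hooks assms(1)) auto
  also have "(\<Prod>x\<in>map_prod Suc id ` young_diagram l. \<phi> (hook_length (p # l) x)) =
    (\<Prod>x\<in>young_diagram l. \<phi> (hook_length l x))"
    by (subst prod.reindex) (auto simp: inj_on_def hook_length_Cons_Suc intro!: prod.cong)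
  also have "\<dots> = beta_weight \<phi> (beta_set l)"
    using Cons by simp
  also have "(\<Prod>b\<in>beta_set l. \<phi> (p + length l - b)) = (\<Prod>b\<in>beta_set l. \<phi> (gap b (p + length l)))"
    using less by (intro prod.cong refl) (fastforce simp: gap_def)
  finally show ?case
    using less beta_weight_insert[of "beta_set l" "p + length l" \<phi>] by (force simp: mult.commute)
qed

section \<open>Padding partitions with zero rows\<close>

text \<open>All zeros of a weakly decreasing list come last, so padding undoes their
  deletion.\<close>

lemma sorted_pad_filter:
  fixes l :: "nat list"
  assumes "sorted_wrt (\<ge>) l"
  shows "filter (\<lambda>p. p \<noteq> 0) l @ replicate (length l - length (filter (\<lambda>p. p \<noteq> 0) l)) 0 = l"
  using assms
proof (induction l)
  case (Cons p l)
  show ?case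
  proof (cases "p = 0")
    case True
    then have z: "\<forall>q\<in>set l. q = 0" using Cons.prems by auto
    then have "filter (\<lambda>p. p \<noteq> 0) l = []" "l = replicate (length l) 0"
      by (auto simp: filter_empty_conv replicate_length_same)
    then show ?thesis using True by simp
  next
    case False
    then show ?thesis using Cons by simp
  qed
qed simp

lemma sorted_append_zeros:
  fixes l :: "nat list"
  assumes "sorted_wrt (\<ge>) l"
  shows "sorted_wrt (\<ge>) (l @ replicate k 0)"
proof -
  have "sorted_wrt (\<ge>) (replicate k (0::nat))"
    by (induction k) auto
  then show ?thesis
    using assms by (auto simp: sorted_wrt_append)
qed

lemma length_le_sum_list:
  fixes l :: "nat list"
  assumes "0 \<notin> set l"
  shows "length l \<le> sum_list l"
  using assms by (induction l) auto

text \<open>Padding leads to lists of the fixed length \<open>k\<close>, on which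
  \<open>beta_set\<close> is injective. A partition of \<open>n\<close> has at most \<open>n\<close>
  parts, so \<open>n \<le> k\<close> leaves room for all.\<close>

lemma bij_betw_partitions_beta_sets:
  assumes "n \<le> k"
  shows "bij_betw (\<lambda>l. beta_set (l @ replicate (k - length l) 0)) (partitions n) (beta_sets k n)"
proof -
  define L :: "nat list set" where "L = {l. length l = k \<and> sorted_wrt (\<ge>) l \<and> sum_list l = n}"
  have "bij_betw (\<lambda>l. l @ replicate (k - length l) 0) (partitions n) L"
  proof (rule bij_betw_byWitness[where f' = "filter (\<lambda>p. p \<noteq> 0)"])
    show "\<forall>l\<in>partitions n. filter (\<lambda>p. p \<noteq> 0) (l @ replicate (k - length l) 0) = l"
      by (auto simp: partitions_def filter_id_conv) (metis gr0I)
    show "\<forall>l\<in>L. filter (\<lambda>p. p \<noteq> 0) l @ replicate (k - length (filter (\<lambda>p. p \<noteq> 0) l)) 0 = l"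
      using sorted_pad_filter by (auto simp: L_def)
    show "(\<lambda>l. l @ replicate (k - length l) 0) ` partitions n \<subseteq> L"
    proof -
      have "length l \<le> k" if "l \<in> partitions n" for l
        using that assms length_le_sum_list[of l] by (simp add: partitions_def)
      then show ?thesis
        by (auto simp: partitions_def L_def sorted_append_zeros sum_list_replicate)
    qed
    have "sum_list (filter (\<lambda>p. p \<noteq> 0) l) = sum_list l" for l :: "nat list"
      by (induction l) auto
    then show "filter (\<lambda>p. p \<noteq> 0) ` L \<subseteq> partitions n"
      by (auto simp: L_def partitions_def sorted_wrt_filter)
  qed
  moreover have "bij_betw beta_set L (beta_sets k n)"
    unfolding bij_betw_def
  proof
    show "inj_on beta_set L"
      by (auto simp: inj_on_def L_def intro: beta_set_inject)
    show "beta_set ` L = beta_sets k n"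
    proof
      show "beta_set ` L \<subseteq> beta_sets k n"
        by (auto simp: L_def beta_sets_def card_beta_set sum_beta_set)
      show "beta_sets k n \<subseteq> beta_set ` L"
      proof
        fix B assume "B \<in> beta_sets k n"
        then have B: "finite B" "card B = k" "\<Sum>B = n + \<Sum>{..<k}"
          by (auto simp: beta_sets_def)
        then obtain l where "sorted_wrt (\<ge>) l" "beta_set l = B"
          using beta_set_surj by blast
        then show "B \<in> beta_set ` L"
          using B card_beta_set[of l] sum_beta_set[of l] by (auto simp: L_def)
      qed
    qed
  qed
  ultimately have "bij_betw (beta_set \<circ> (\<lambda>l. l @ replicate (k - length l) 0)) (partitions n) (beta_sets k n)"
    by (rule bij_betw_trans)
  then show ?thesis by (simp add: comp_def)
qed

text \<open>Zero rows carry no cells, so padding preserves all hooks, and one \<open>k\<close> can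
  serve several \<open>n\<close>.\<close>

lemma sum_partitions_eq_sum_beta_sets:
  fixes \<phi> :: "nat \<Rightarrow> 'a::field"
  assumes "\<And>h. h > 0 \<Longrightarrow> \<phi> h \<noteq> 0" "n \<le> k"
  shows "(\<Sum>l\<in>partitions n. \<Prod>x\<in>young_diagram l. \<phi> (hook_length l x)) =
    (\<Sum>B\<in>beta_sets k n. beta_weight \<phi> B)"
proof -
  have "(\<Prod>x\<in>young_diagram l. \<phi> (hook_length l x)) =
    beta_weight \<phi> (beta_set (l @ replicate (k - length l) 0))" if "l \<in> partitions n" for l
  proof -
    let ?l = "l @ replicate (k - length l) 0"
    have "young_diagram ?l = young_diagram l"
      by (auto simp: young_diagram_def nth_append split: if_splits)
    moreover from this have "hook_length ?l = hook_length l"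
      by (simp add: hook_length_def)
    moreover have "sorted_wrt (\<ge>) ?l"
      using that by (simp add: partitions_def sorted_append_zeros)
    ultimately show ?thesis
      using prod_hook_length_eq_beta_weight[of \<phi> ?l] assms(1) by simp
  qed
  then have "(\<Sum>l\<in>partitions n. \<Prod>x\<in>young_diagram l. \<phi> (hook_length l x)) =
    (\<Sum>l\<in>partitions n. beta_weight \<phi> (beta_set (l @ replicate (k - length l) 0)))"
    by (rule sum.cong[OF refl])
  also have "\<dots> = (\<Sum>B\<in>beta_sets k n. beta_weight \<phi> B)"
    by (rule sum.reindex_bij_betw[OF bij_betw_partitions_beta_sets[OF assms(2)]])
  finally show ?thesis .
qed

section \<open>Adding and deleting cells\<close>

text \<open>The odd extension of \<open>\<phi>\<close> to differences of either sign; its value 0 at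
  equal arguments annihilates illegal moves in the sums below.\<close>

definition signed :: "(nat \<Rightarrow> 'a::field) \<Rightarrow> nat \<Rightarrow> nat \<Rightarrow> 'a" where
  "signed \<phi> a b = (if b < a then \<phi> (a - b) else if a < b then - \<phi> (b - a) else 0)"

lemma signed_Suc_Suc [simp]: "signed \<phi> (Suc a) (Suc b) = signed \<phi> a b"
  by (simp add: signed_def)

text \<open>If the next value is occupied, the row above has the same length and blocks a new
  cell.\<close>

definition addable :: "nat set \<Rightarrow> nat set" where
  "addable B = {b. b \<in> B \<and> Suc b \<notin> B}"

text \<open>A removable cell is named by the value after the decrement, so \<open>raise c\<close>
  and \<open>lower c\<close> undo each other.\<close>

definition removable :: "nat set \<Rightarrow> nat set" where
  "removable B = {c. Suc c \<in> B \<and> c \<notin> B}"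

definition raise :: "nat \<Rightarrow> nat set \<Rightarrow> nat set" where
  "raise b B = insert (Suc b) (B - {b})"

definition lower :: "nat \<Rightarrow> nat set \<Rightarrow> nat set" where
  "lower c B = insert c (B - {Suc c})"

lemma finite_addable [simp]: "finite B \<Longrightarrow> finite (addable B)"
  by (simp add: addable_def)

lemma finite_removable [simp]: "finite B \<Longrightarrow> finite (removable B)"
  by (rule finite_subset[of _ "(\<lambda>b. b - 1) ` B"]) (force simp: removable_def image_iff)+

text \<open>Only factors of the moved element change. Every other element has \<open>b\<close> and
  \<open>Suc b\<close> on the same side, so the signs cancel in each quotient.\<close>

lemma beta_weight_insert_Suc:
  fixes \<phi> :: "nat \<Rightarrow> 'a::field"
  assumes "\<And>h. h > 0 \<Longrightarrow> \<phi> h \<noteq> 0" "finite C" "b \<notin> C" "Suc b \<notin> C"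
  shows "beta_weight \<phi> (insert (Suc b) C) =
    beta_weight \<phi> (insert b C) * (\<phi> (Suc b) * (\<Prod>a\<in>C. signed \<phi> b a / signed \<phi> (Suc b) a))"
proof -
  have "signed \<phi> b a / signed \<phi> (Suc b) a = \<phi> (gap a b) / \<phi> (gap a (Suc b))" if "a \<in> C" for a
  proof -
    have "a \<noteq> b" "a \<noteq> Suc b" using that assms by auto
    then show ?thesis by (auto simp: signed_def gap_def)
  qed
  moreover have "\<phi> (gap a b) \<noteq> 0" if "a \<in> C" for a
  proof (rule assms(1))
    have "a \<noteq> b" using that assms by auto
    then show "gap a b > 0" by (auto simp: gap_def)
  qed
  then have "(\<Prod>a\<in>C. \<phi> (gap a b)) \<noteq> 0"
    using assms by simp
  ultimately show ?thesis
    using assms by (simp add: beta_weight_insert prod_dividef mult_ac)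
qed

text \<open>Extends the sum to all of \<open>B\<close>, as partial fractions require.\<close>

lemma sum_raise:
  fixes \<phi> :: "nat \<Rightarrow> 'a::field"
  assumes "\<And>h. h > 0 \<Longrightarrow> \<phi> h \<noteq> 0" "finite B"
  shows "(\<Sum>b\<in>addable B. beta_weight \<phi> (raise b B)) =
    beta_weight \<phi> B * (\<Sum>b\<in>B. \<phi> (Suc b) * (\<Prod>a\<in>B - {b}. signed \<phi> b a / signed \<phi> (Suc b) a))"
proof -
  have "(\<Sum>b\<in>addable B. beta_weight \<phi> (raise b B)) =
    (\<Sum>b\<in>addable B. beta_weight \<phi> B * (\<phi> (Suc b) * (\<Prod>a\<in>B - {b}. signed \<phi> b a / signed \<phi> (Suc b) a)))"
  proof (intro sum.cong refl)
    fix b assume "b \<in> addable B"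
    then show "beta_weight \<phi> (raise b B) =
        beta_weight \<phi> B * (\<phi> (Suc b) * (\<Prod>a\<in>B - {b}. signed \<phi> b a / signed \<phi> (Suc b) a))"
      using beta_weight_insert_Suc[of \<phi> "B - {b}" b] assms
      by (simp add: addable_def raise_def insert_absorb)
  qed
  also have "\<dots> = (\<Sum>b\<in>B. beta_weight \<phi> B * (\<phi> (Suc b) * (\<Prod>a\<in>B - {b}. signed \<phi> b a / signed \<phi> (Suc b) a)))"
  proof (intro sum.mono_neutral_left ballI)
    fix b assume "b \<in> B - addable B"
    \<comment> \<open>For a blocked increment the factor at \<open>a = Suc b\<close> has denominator
      0, so the quotient is 0 by convention.\<close>
    then have "\<exists>a\<in>B - {b}. signed \<phi> b a / signed \<phi> (Suc b) a = 0"
      by (intro bexI[of _ "Suc b"]) (auto simp: addable_def signed_def)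
    then show "beta_weight \<phi> B * (\<phi> (Suc b) * (\<Prod>a\<in>B - {b}. signed \<phi> b a / signed \<phi> (Suc b) a)) = 0"
      using assms(2) prod_zero[of "B - {b}"] by simp
  qed (use assms in \<open>auto simp: addable_def\<close>)
  finally show ?thesis by (simp add: sum_distrib_left)
qed

text \<open>Lowering inverts raising, so every factor is inverted. The element 0 cannot be lowered;
  a positive one with occupied predecessor contributes 0 through division by zero.\<close>

lemma sum_lower:
  fixes \<phi> :: "nat \<Rightarrow> 'a::field"
  assumes "\<And>h. h > 0 \<Longrightarrow> \<phi> h \<noteq> 0" "finite B"
  shows "(\<Sum>c\<in>removable B. beta_weight \<phi> (lower c B)) =
    beta_weight \<phi> B * (\<Sum>b\<in>B - {0}. inverse (\<phi> b) * (\<Prod>a\<in>B - {b}. signed \<phi> b a / signed \<phi> (b - 1) a))"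
proof -
  define t where "t b = beta_weight \<phi> B * (inverse (\<phi> b) * (\<Prod>a\<in>B - {b}. signed \<phi> b a / signed \<phi> (b - 1) a))" for b
  have "(\<Sum>c\<in>removable B. beta_weight \<phi> (lower c B)) = (\<Sum>c\<in>removable B. t (Suc c))"
  proof (intro sum.cong refl)
    fix c assume c: "c \<in> removable B"
    define C where "C = B - {Suc c}"
    have C: "finite C" "c \<notin> C" "Suc c \<notin> C" "insert (Suc c) C = B" "lower c B = insert c C"
      using c assms(2) by (auto simp: C_def removable_def lower_def)
    have "signed \<phi> c a / signed \<phi> (Suc c) a \<noteq> 0" if "a \<in> C" for a
    proof -
      have "a \<noteq> c" "a \<noteq> Suc c" using C that by auto
      then show ?thesis using assms(1) by (auto simp: signed_def)
    qed
    then have "(\<Prod>a\<in>C. signed \<phi> c a / signed \<phi> (Suc c) a) \<noteq> 0"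
      using C(1) by (simp add: prod_zero_iff)
    moreover have "(\<Prod>a\<in>C. signed \<phi> (Suc c) a / signed \<phi> c a) =
      inverse (\<Prod>a\<in>C. signed \<phi> c a / signed \<phi> (Suc c) a)"
      by (simp add: prod_inversef[symmetric])
    moreover have "\<phi> (Suc c) \<noteq> 0"
      using assms(1) by simp
    moreover have "beta_weight \<phi> B =
        beta_weight \<phi> (lower c B) * (\<phi> (Suc c) * (\<Prod>a\<in>C. signed \<phi> c a / signed \<phi> (Suc c) a))"
      using beta_weight_insert_Suc[of \<phi> C c] C assms(1) by simp
    ultimately show "beta_weight \<phi> (lower c B) = t (Suc c)"
      by (simp add: t_def field_simps flip: C_def)
  qed
  also have "\<dots> = (\<Sum>b\<in>Suc ` removable B. t b)"
    by (simp add: sum.reindex)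
  also have "\<dots> = (\<Sum>b\<in>B - {0}. t b)"
  proof (intro sum.mono_neutral_left ballI)
    fix b assume b: "b \<in> (B - {0}) - Suc ` removable B"
    then obtain c where "b = Suc c" by (cases b) auto
    then have "\<exists>a\<in>B - {b}. signed \<phi> b a / signed \<phi> (b - 1) a = 0"
      using b by (intro bexI[of _ c]) (auto simp: removable_def signed_def)
    then show "t b = 0"
      using assms(2) prod_zero[of "B - {b}"] by (simp add: t_def)
  qed (use assms in \<open>auto simp: removable_def\<close>)
  finally show ?thesis by (simp add: sum_distrib_left t_def)
qed

section \<open>Levels of Young's lattice as families of beta-sets\<close>

lemma finite_beta_sets: "finite (beta_sets k n)"
proof (rule finite_subset)
  show "beta_sets k n \<subseteq> Pow {..n + \<Sum>{..<k}}"
  proof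
    fix B assume "B \<in> beta_sets k n"
    then show "B \<in> Pow {..n + \<Sum>{..<k}}"
      using member_le_sum[of _ B "\<lambda>b. b"] by (auto simp: beta_sets_def)
  qed
qed simp

lemma sum_lessThan_card_le:
  fixes B :: "nat set"
  assumes "finite B"
  shows "\<Sum>{..<card B} \<le> \<Sum>B"
proof -
  obtain l where "sorted_wrt (\<ge>) l" "beta_set l = B"
    using beta_set_surj[OF assms] by blast
  then show ?thesis
    using sum_beta_set[of l] card_beta_set[of l] by simp
qed

text \<open>A partition of \<open>n < k\<close> padded to \<open>k\<close> rows ends in a zero row.
  On sets: without 0 every element could drop by one, forcing \<open>n \<ge> k\<close>.\<close>

lemma zero_in_beta_set:
  assumes "B \<in> beta_sets k n" "n < k"
  shows "0 \<in> B"
proof (rule ccontr)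
  assume 0: "0 \<notin> B"
  have B: "finite B" "card B = k" "\<Sum>B = n + \<Sum>{..<k}"
    using assms by (auto simp: beta_sets_def)
  define C where "C = (\<lambda>b. b - 1) ` B"
  have inj: "inj_on (\<lambda>b. b - 1) B"
    using 0 by (intro inj_onI) (metis Suc_diff_1 gr0I)
  have "\<Sum>B = (\<Sum>b\<in>B. (b - 1) + 1)"
    using 0 by (intro sum.cong refl) (metis Suc_diff_1 Suc_eq_plus1 gr0I)
  also have "\<dots> = \<Sum>C + k"
    using inj B by (simp add: C_def sum.reindex sum_Suc)
  finally have "\<Sum>B = \<Sum>C + k" .
  moreover have "\<Sum>{..<k} \<le> \<Sum>C"
    using sum_lessThan_card_le[of C] B inj by (simp add: C_def card_image)
  ultimately show False using B assms by simp
qed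

lemma raise_lower:
  assumes "c \<in> removable B"
  shows "raise c (lower c B) = B" "c \<in> addable (lower c B)"
  using assms by (auto simp: removable_def addable_def raise_def lower_def)

lemma lower_raise:
  assumes "b \<in> addable B"
  shows "lower b (raise b B) = B" "b \<in> removable (raise b B)"
  using assms by (auto simp: removable_def addable_def raise_def lower_def)

lemma sum_raise_eq: "finite B \<Longrightarrow> b \<in> addable B \<Longrightarrow> \<Sum>(raise b B) = Suc (\<Sum>B)"
  by (auto simp: raise_def addable_def sum.remove[of B b])

lemma raise_in_beta_sets:
  assumes "B \<in> beta_sets k n" "b \<in> addable B"
  shows "raise b B \<in> beta_sets k (Suc n)"
  using assms sum_raise_eq[of B b] card_Suc_Diff1[of B b]
  by (auto simp: beta_sets_def) (auto simp: raise_def addable_def)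

lemma lower_in_beta_sets:
  assumes "B \<in> beta_sets k (Suc n)" "c \<in> removable B"
  shows "lower c B \<in> beta_sets k n"
proof -
  have "finite B" using assms by (simp add: beta_sets_def)
  moreover have "card (lower c B) = card B"
    using assms card_Suc_Diff1[of B "Suc c"] by (simp add: lower_def removable_def beta_sets_def)
  moreover have "\<Sum>B = Suc (\<Sum>(lower c B))"
    using sum_raise_eq[of "lower c B" c] raise_lower[OF assms(2)] assms(1)
    by (simp add: lower_def beta_sets_def)
  ultimately show ?thesis
    using assms by (simp add: beta_sets_def) (simp add: lower_def)
qed

text \<open>The sum is already the least possible for \<open>k\<close> elements.\<close>

lemma removable_beta_sets_0:
  assumes "B \<in> beta_sets k 0"
  shows "removable B = {}"
proof (rule ccontr)
  assume "removable B \<noteq> {}"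
  then obtain c where c: "c \<in> removable B" by blast
  have B: "finite B" "card B = k" "\<Sum>B = \<Sum>{..<k}"
    using assms by (auto simp: beta_sets_def)
  have "finite (lower c B)" "card (lower c B) = k"
    using B c card_Suc_Diff1[of B "Suc c"] by (simp_all add: lower_def removable_def)
  then show False
    using sum_lessThan_card_le[of "lower c B"] sum_raise_eq[of "lower c B" c] raise_lower[OF c] B by simp
qed

text \<open>Double counting of the pairs that differ by one cell; \<open>F\<close> takes the larger
  set first.\<close>

lemma sum_removable_eq_sum_addable:
  fixes F :: "nat set \<Rightarrow> nat set \<Rightarrow> 'a::comm_monoid_add"
  shows "(\<Sum>B\<in>beta_sets k (Suc n). \<Sum>c\<in>removable B. F B (lower c B)) =
    (\<Sum>B\<in>beta_sets k n. \<Sum>b\<in>addable B. F (raise b B) B)"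
proof -
  have fin: "finite B" if "B \<in> beta_sets k m" for B m
    using that by (simp add: beta_sets_def)
  have "(\<Sum>B\<in>beta_sets k (Suc n). \<Sum>c\<in>removable B. F B (lower c B)) =
    (\<Sum>(B, c)\<in>(SIGMA B : beta_sets k (Suc n). removable B). F B (lower c B))"
    by (rule sum.Sigma) (auto simp: finite_beta_sets fin)
  also have "\<dots> = (\<Sum>(B, b)\<in>(SIGMA B : beta_sets k n. addable B). F (raise b B) B)"
    by (rule sum.reindex_bij_witness[of _ "\<lambda>(B, b). (raise b B, b)" "\<lambda>(B, c). (lower c B, c)"])
      (auto simp: raise_lower lower_raise raise_in_beta_sets lower_in_beta_sets)
  also have "\<dots> = (\<Sum>B\<in>beta_sets k n. \<Sum>b\<in>addable B. F (raise b B) B)"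
    by (rule sum.Sigma [symmetric]) (auto simp: finite_beta_sets fin)
  finally show ?thesis .
qed

section \<open>Local identities for inverse hook lengths\<close>

lemma signed_inverse:
  "signed (\<lambda>h. inverse (of_nat h)) a b = inverse (of_nat a - of_nat b :: 'a::field_char_0)"
  by (auto simp: signed_def of_nat_diff simp flip: inverse_minus_eq)

text \<open>Expand the product of the \<open>1 + 1 / (t - b)\<close> and set \<open>t = -1\<close>,
  where the factor of \<open>b = 0\<close> vanishes.\<close>

lemma sum_raise_inverse_hooks:
  fixes B :: "nat set"
  defines "H \<equiv> beta_weight (\<lambda>h. inverse (of_nat h :: 'a::field_char_0))"
  assumes "finite B" "0 \<in> B"
  shows "(\<Sum>b\<in>addable B. H (raise b B)) = H B"
proof -
  define R :: "nat \<Rightarrow> 'a" where "R b = (\<Prod>a\<in>B - {b}. 1 + 1 / (of_nat b - of_nat a))" for b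
  have inj: "inj_on (of_nat :: nat \<Rightarrow> 'a) B" by (simp add: inj_on_def)
  have nm: "(- 1 :: 'a) \<notin> of_nat ` B"
    by (metis imageE of_nat_neq_0 of_nat_Suc add.commute add.right_inverse)
  have "(\<Prod>b\<in>B. 1 + 1 / (- 1 - of_nat b :: 'a)) = 0"
    using assms by (intro prod_zero bexI[of _ 0]) auto
  then have "1 + (\<Sum>b\<in>B. R b / (- 1 - of_nat b)) = 0"
    using prod_partial_fractions[OF assms(2) inj nm, of "\<lambda>_. 1" "\<lambda>_. 1"] by (simp add: R_def)
  then have R: "(\<Sum>b\<in>B. R b / (- 1 - of_nat b)) = - 1"
    by (simp add: eq_neg_iff_add_eq_0 add.commute)
  have "inverse (of_nat (Suc b)) * (\<Prod>a\<in>B - {b}. signed (\<lambda>h. inverse (of_nat h)) b a /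
      signed (\<lambda>h. inverse (of_nat h)) (Suc b) a) = - (R b / (- 1 - of_nat b))" if "b \<in> B" for b
  proof -
    \<comment> \<open>At a blocked position \<open>a = Suc b\<close> both factors are 0, the left
      one by division by zero.\<close>
    have "(\<Prod>a\<in>B - {b}. signed (\<lambda>h. inverse (of_nat h)) b a /
      signed (\<lambda>h. inverse (of_nat h)) (Suc b) a) = R b"
      unfolding R_def signed_inverse
      by (intro prod.cong refl) (auto simp: divide_simps)
    moreover have "- 1 - of_nat b = - (of_nat (Suc b) :: 'a)" by simp
    ultimately show ?thesis
      by (simp only: minus_divide_right minus_minus) (simp add: divide_inverse mult.commute)
  qed
  then have "(\<Sum>b\<in>B. inverse (of_nat (Suc b)) * (\<Prod>a\<in>B - {b}. signed (\<lambda>h. inverse (of_nat h)) b a /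
      signed (\<lambda>h. inverse (of_nat h)) (Suc b) a)) = (1 :: 'a)"
    using R by (simp add: sum_negf)
  then show ?thesis
    unfolding H_def using assms by (subst sum_raise) auto
qed

text \<open>This is the branching rule for standard tableaux. In \<open>sum_residues_shift\<close>
  the sum of \<open>B\<close> less that of \<open>{..<k}\<close> is \<open>n\<close>.\<close>

lemma sum_lower_inverse_hooks:
  fixes B :: "nat set"
  defines "H \<equiv> beta_weight (\<lambda>h. inverse (of_nat h :: 'a::field_char_0))"
  assumes "B \<in> beta_sets k n"
  shows "(\<Sum>c\<in>removable B. H (lower c B)) = of_nat n * H B"
proof -
  have B: "finite B" "card B = k" "\<Sum>B = n + \<Sum>{..<k}"
    using assms by (auto simp: beta_sets_def)
  have inj: "inj_on (of_nat :: nat \<Rightarrow> 'a) B" by (simp add: inj_on_def)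
  have "(\<Sum>b\<in>B - {0}. inverse (inverse (of_nat b)) * (\<Prod>a\<in>B - {b}. signed (\<lambda>h. inverse (of_nat h)) b a /
      signed (\<lambda>h. inverse (of_nat h)) (b - 1) a)) =
    (\<Sum>b\<in>B - {0}. of_nat b * (\<Prod>a\<in>B - {b}. 1 - 1 / (of_nat b - of_nat a :: 'a)))"
  proof (intro sum.cong refl)
    fix b assume "b \<in> B - {0}"
    then have b: "of_nat (b - 1) = (of_nat b - 1 :: 'a)"
      by (simp add: of_nat_diff)
    have "(\<Prod>a\<in>B - {b}. signed (\<lambda>h. inverse (of_nat h)) b a / signed (\<lambda>h. inverse (of_nat h)) (b - 1) a) =
      (\<Prod>a\<in>B - {b}. 1 - 1 / (of_nat b - of_nat a :: 'a))"
      unfolding signed_inverse b by (intro prod.cong refl) (auto simp: divide_simps)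
    then show "inverse (inverse (of_nat b)) * (\<Prod>a\<in>B - {b}. signed (\<lambda>h. inverse (of_nat h)) b a /
        signed (\<lambda>h. inverse (of_nat h)) (b - 1) a) =
      of_nat b * (\<Prod>a\<in>B - {b}. 1 - 1 / (of_nat b - of_nat a :: 'a))"
      by simp
  qed
  also have "\<dots> = (\<Sum>b\<in>B. of_nat b * (\<Prod>a\<in>B - {b}. 1 - 1 / (of_nat b - of_nat a :: 'a)))"
    using B(1) by (intro sum.mono_neutral_left) auto
  also have "\<dots> = of_nat (\<Sum>B) - of_nat (\<Sum>{..<k})"
    using sum_residues_shift(2)[OF B(1) inj] B(2) by simp
  also have "\<dots> = of_nat n"
    unfolding B(3) by simp
  finally show ?thesis
    unfolding H_def using B(1) by (subst sum_lower) (auto simp: mult.commute)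
qed

section \<open>The cotangent weight\<close>

text \<open>With \<open>w^2 = z\<close>, \<open>coth_num z n\<close> and \<open>coth_den z n\<close>
  are the coordinates of \<open>(1 + w)^n\<close> in the basis \<open>1\<close>,
  \<open>w\<close>.\<close>

definition coth_num :: "'a::comm_semiring_1 \<Rightarrow> nat \<Rightarrow> 'a" where
  "coth_num z n = (\<Sum>k\<le>n. of_nat (n choose (2 * k)) * z ^ k)"

definition coth_den :: "'a::comm_semiring_1 \<Rightarrow> nat \<Rightarrow> 'a" where
  "coth_den z n = (\<Sum>k\<le>n. of_nat (n choose (2 * k + 1)) * z ^ k)"

lemma coth_num_0 [simp]: "coth_num z 0 = 1"
  and coth_den_0 [simp]: "coth_den z 0 = 0"
  by (simp_all add: coth_num_def coth_den_def)

lemma coth_num_Suc: "coth_num z (Suc n) = coth_num z n + z * coth_den z n"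
proof -
  \<comment> \<open>The raised cut-off adds a zero term and aligns the ranges for Pascal's
    rule.\<close>
  have "coth_num z n = (\<Sum>k\<le>Suc n. of_nat (n choose (2 * k)) * z ^ k)"
    by (simp add: coth_num_def binomial_eq_0)
  also have "\<dots> = 1 + (\<Sum>k\<le>n. of_nat (n choose (2 * Suc k)) * z ^ Suc k)"
    unfolding sum.atMost_Suc_shift by simp
  finally have "coth_num z n = \<dots>" .
  moreover have "coth_num z (Suc n) = 1 + ((\<Sum>k\<le>n. of_nat (n choose (2 * Suc k)) * z ^ Suc k) +
      (\<Sum>k\<le>n. of_nat (n choose (2 * k + 1)) * z ^ Suc k))"
    unfolding coth_num_def sum.atMost_Suc_shift
    by (simp add: algebra_simps flip: sum.distrib)
  ultimately show ?thesis
    by (simp add: coth_den_def sum_distrib_left mult_ac add.assoc)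
qed

lemma coth_den_Suc: "coth_den z (Suc n) = coth_num z n + coth_den z n"
  by (simp add: coth_num_def coth_den_def binomial_eq_0 distrib_right sum.distrib)

text \<open>The product of \<open>(1 + w)^a\<close> and \<open>(1 + w)^b\<close> in
  coordinates.\<close>

lemma coth_num_add: "coth_num z (a + b) = coth_num z a * coth_num z b + z * coth_den z a * coth_den z b"
  and coth_den_add: "coth_den z (a + b) = coth_num z a * coth_den z b + coth_den z a * coth_num z b"
  by (induction b) (simp_all add: coth_num_Suc coth_den_Suc algebra_simps)

text \<open>The norm is multiplicative, and \<open>1 + w\<close> has norm
  \<open>1 - z\<close>.\<close>

lemma coth_norm:
  fixes z :: "'a::comm_ring_1"
  shows "coth_num z n ^ 2 - z * coth_den z n ^ 2 = (1 - z) ^ n"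
proof (induction n)
  case (Suc n)
  have "coth_num z (Suc n) ^ 2 - z * coth_den z (Suc n) ^ 2 =
    (1 - z) * (coth_num z n ^ 2 - z * coth_den z n ^ 2)"
    by (simp add: coth_num_Suc coth_den_Suc power2_eq_square algebra_simps)
  then show ?case by (simp add: Suc)
qed simp

lemma rho_eq: "rho n z = coth_num z n / coth_den z n * inverse (of_nat n)"
  by (simp add: rho_def coth_num_def coth_den_def divide_inverse mult.commute)

text \<open>
  For \<open>z = w\<^sup>2\<close> and \<open>q = (1 - w) / (1 + w)\<close> the quotient \<open>coth_num z n / coth_den z n\<close> equals
  \<open>w * (1 + q ^ n) / (1 - q ^ n)\<close>, a hyperbolic cotangent; its addition theorem needs no square
  root of \<open>z\<close>.
\<close>

locale generic_coth =
  fixes z :: "'a::field_char_0"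
  assumes z0: "z \<noteq> 0" and z1: "z \<noteq> 1"
    and num_nz: "coth_num z n \<noteq> 0" and den_nz: "n > 0 \<Longrightarrow> coth_den z n \<noteq> 0"
begin

definition coth :: "nat \<Rightarrow> 'a" where
  "coth n = coth_num z n / coth_den z n"

lemma coth_nonzero: "n > 0 \<Longrightarrow> coth n \<noteq> 0"
  by (simp add: coth_def num_nz den_nz)

lemma coth_1: "coth (Suc 0) = 1"
  using coth_num_Suc[of z 0] coth_den_Suc[of z 0] by (simp add: coth_def)

text \<open>Multiplying \<open>(1 + w)^(b + h)\<close> by the conjugate of \<open>(1 + w)^b\<close>
  gives the norm \<open>n\<close> times \<open>(1 + w)^h\<close>; facts \<open>1\<close> and
  \<open>2\<close> are the two coordinates.\<close>

lemma coth_diff: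
  assumes "b > 0" "h > 0"
  shows "coth (b + h) \<noteq> coth b" "coth (b + h) * coth b \<noteq> z"
    "(z - coth (b + h) * coth b) / (coth (b + h) - coth b) = coth h"
proof -
  define n where "n = (1 - z) ^ b"
  have n: "n \<noteq> 0" using z1 by (simp add: n_def)
  let ?N = "coth_num z" and ?D = "coth_den z"
  have d: "?D b \<noteq> 0" "?D (b + h) \<noteq> 0" "?D h \<noteq> 0" "?N h \<noteq> 0"
    using assms den_nz num_nz by auto
  have 1: "?N b * ?D (b + h) - ?N (b + h) * ?D b = n * ?D h"
    unfolding n_def coth_norm[of z b, symmetric]
    by (simp add: coth_num_add coth_den_add power2_eq_square algebra_simps)
  have 2: "?N b * ?N (b + h) - z * ?D (b + h) * ?D b = n * ?N h"
    unfolding n_def coth_norm[of z b, symmetric]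
    by (simp add: coth_num_add coth_den_add power2_eq_square algebra_simps)
  have 3: "coth (b + h) - coth b = - (n * ?D h) / (?D b * ?D (b + h))"
    unfolding 1[symmetric] using d by (simp add: coth_def divide_simps)
  have 4: "z - coth (b + h) * coth b = - (n * ?N h) / (?D b * ?D (b + h))"
    unfolding 2[symmetric] using d by (simp add: coth_def divide_simps)
  have "coth (b + h) - coth b \<noteq> 0" "z - coth (b + h) * coth b \<noteq> 0"
    unfolding 3 4 using d n by auto
  then show "coth (b + h) \<noteq> coth b" "coth (b + h) * coth b \<noteq> z"
    by auto
  show "(z - coth (b + h) * coth b) / (coth (b + h) - coth b) = coth h"
    unfolding 3 4 using d n by (simp add: coth_def)
qed

text \<open>The shift by one avoids the pole of the cotangent at 0.\<close>

lemma inj_coth_Suc: "inj (\<lambda>a. coth (Suc a))"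
proof (rule injI)
  fix a b assume eq: "coth (Suc a) = coth (Suc b)"
  show "a = b"
  proof (cases a b rule: linorder_cases)
    case less
    then show ?thesis using coth_diff(1)[of "Suc a" "b - a"] eq by simp
  next
    case greater
    then show ?thesis using coth_diff(1)[of "Suc b" "a - b"] eq by simp
  qed simp
qed

lemma coth_Suc_mult_neq: "coth (Suc a) * coth (Suc b) \<noteq> z"
proof (cases a b rule: linorder_cases)
  case less
  then show ?thesis using coth_diff(2)[of "Suc a" "b - a"] by (simp add: mult.commute)
next
  case greater
  then show ?thesis using coth_diff(2)[of "Suc b" "a - b"] by simp
next
  case equal
  let ?a = "Suc a"
  \<comment> \<open>If the square of \<open>coth ?a\<close> were \<open>z\<close>, this norm would
    vanish.\<close>
  have "coth_num z ?a ^ 2 - z * coth_den z ?a ^ 2 \<noteq> 0"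
    unfolding coth_norm using z1 by simp
  then show ?thesis
    using equal den_nz[of ?a] by (auto simp: coth_def field_simps power2_eq_square)
qed

text \<open>Shifting both arguments keeps their difference; at \<open>a = b\<close> the right side
  is 0 by division by zero.\<close>

lemma signed_coth:
  "signed coth a b = (z - coth (Suc a) * coth (Suc b)) / (coth (Suc a) - coth (Suc b))"
proof (cases a b rule: linorder_cases)
  case less
  then have "coth (b - a) = (z - coth (Suc b) * coth (Suc a)) / (coth (Suc b) - coth (Suc a))"
    using coth_diff(3)[of "Suc a" "b - a"] by simp
  moreover have "coth (Suc a) - coth (Suc b) = - (coth (Suc b) - coth (Suc a))" by simp
  ultimately show ?thesis
    using less by (simp only: signed_def minus_divide_right mult.commute) simp
next
  case greater
  then show ?thesis using coth_diff(3)[of "Suc b" "a - b"] by (simp add: signed_def)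
qed (simp add: signed_def)

text \<open>
  The cotangent sum over the points \<open>coth (x + 1)\<close>, for \<open>x\<close> in \<open>{0} \<union> Suc ` B\<close>, together with
  \<open>z / coth (b + 1)\<close>, for \<open>b \<in> B\<close>: dividing \<open>z\<close> by a point inverts the factors that mix the two
  families.
\<close>

lemma sum_signed_coth:
  fixes B :: "nat set"
  assumes "finite B" "0 \<in> B"
  shows "(\<Sum>b\<in>B. coth (Suc b) * (\<Prod>a\<in>B - {b}. signed coth b a / signed coth (Suc b) a)) =
    1 + z * (\<Sum>b\<in>B - {0}. inverse (coth b) * (\<Prod>a\<in>B - {b}. signed coth b a / signed coth (b - 1) a))"
proof -
  define u where "u a = coth (Suc a)" for a
  define k where "k = card B"
  \<comment> \<open>The beta-set of the same partition with one more zero row. Its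
    \<open>Suc b\<close> yields the term raising \<open>b\<close>; \<open>b\<close> in the second
    family yields the term lowering \<open>b\<close>.\<close>
  define X where "X = insert 0 (Suc ` B)"
  define f where "f = case_sum u (\<lambda>b. z / u b)"
  have u: "u a \<noteq> 0" "u a * u b \<noteq> z" "u a = u b \<longleftrightarrow> a = b" for a b
    using coth_nonzero coth_Suc_mult_neq inj_coth_Suc by (auto simp: u_def inj_def)
  have g: "signed coth a b = (z - u a * u b) / (u a - u b)" for a b
    by (simp add: signed_coth u_def)
  have X: "finite X" "card X = Suc k"
    using assms by (auto simp: X_def k_def card_image)
  have inj: "inj_on f (X <+> B)"
  proof -
    have "z / u b \<noteq> u a" "z / u a = z / u b \<longleftrightarrow> a = b" for a b
      using u(1)[of b] u(1)[of a] u(2,3)[of a b] z0 by (auto simp: divide_simps)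
    then show ?thesis
      using u by (auto simp: inj_on_def f_def) metis+
  qed
  define T where "T i = (\<Prod>j\<in>(X <+> B) - {i}. (z - f i * f j) / (f i - f j))" for i
  \<comment> \<open>There are \<open>2 * k + 1\<close> points, an odd number.\<close>
  have "(\<Sum>i\<in>X <+> B. T i) = z ^ k"
    using sum_prod_coth_difference[OF _ inj, of z] X assms
    by (simp add: T_def card_Plus k_def flip: mult_2)
  moreover have "(\<Sum>i\<in>X <+> B. T i) = (\<Sum>x\<in>X. T (Inl x)) + (\<Sum>b\<in>B. T (Inr b))"
    using X assms by (simp add: sum.Plus)
  moreover have Inl: "T (Inl x) = z ^ k * ((\<Prod>y\<in>X - {x}. signed coth x y) * (\<Prod>b\<in>B. inverse (signed coth x b)))"
    for x
  proof -
    have "(X <+> B) - {Inl x} = (X - {x}) <+> B" by auto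
    then have "T (Inl x) = (\<Prod>y\<in>X - {x}. signed coth x y) * (\<Prod>b\<in>B. (z - u x * (z / u b)) / (u x - z / u b))"
      using X assms by (simp add: T_def prod.Plus f_def g)
    also have "(\<Prod>b\<in>B. (z - u x * (z / u b)) / (u x - z / u b)) = (\<Prod>b\<in>B. z * inverse (signed coth x b))"
    proof (intro prod.cong refl)
      fix b
      show "(z - u x * (z / u b)) / (u x - z / u b) = z * inverse (signed coth x b)"
        using u(1)[of b] u(2,3)[of x b] unfolding g by (simp add: divide_simps) (simp add: algebra_simps)
    qed
    finally show ?thesis
      using assms by (simp add: prod.distrib k_def)
  qed
  moreover have Inr: "T (Inr b) = z ^ Suc k * ((\<Prod>a\<in>B - {b}. signed coth b a) * (\<Prod>x\<in>X. inverse (signed coth b x)))"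
    for b
  proof -
    have "(X <+> B) - {Inr b} = X <+> (B - {b})" by auto
    then have "T (Inr b) = (\<Prod>x\<in>X. (z - z / u b * u x) / (z / u b - u x)) *
        (\<Prod>a\<in>B - {b}. (z - z / u b * (z / u a)) / (z / u b - z / u a))"
      using X assms by (simp add: T_def prod.Plus f_def mult.commute)
    also have "(\<Prod>x\<in>X. (z - z / u b * u x) / (z / u b - u x)) = (\<Prod>x\<in>X. z * inverse (signed coth b x))"
    proof (intro prod.cong refl)
      fix x
      show "(z - z / u b * u x) / (z / u b - u x) = z * inverse (signed coth b x)"
        using u(1)[of b] u(2,3)[of b x] unfolding g by (simp add: divide_simps) (simp add: algebra_simps)
    qed
    also have "(\<Prod>a\<in>B - {b}. (z - z / u b * (z / u a)) / (z / u b - z / u a)) = (\<Prod>a\<in>B - {b}. signed coth b a)"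
    proof (intro prod.cong refl)
      fix a assume "a \<in> B - {b}"
      then show "(z - z / u b * (z / u a)) / (z / u b - z / u a) = signed coth b a"
        using u(1)[of b] u(1)[of a] u(2,3)[of b a] z0 unfolding g by (simp add: divide_simps) (simp add: algebra_simps)
    qed
    finally show ?thesis
      using X by (simp add: prod.distrib)
  qed
  moreover have "(\<Sum>x\<in>X. T (Inl x)) = z ^ k * (\<Sum>b\<in>B. coth (Suc b) * (\<Prod>a\<in>B - {b}. signed coth b a / signed coth (Suc b) a))"
  proof -
    \<comment> \<open>As 0 lies in \<open>B\<close>, the convention \<open>inverse 0 = 0\<close>
      removes the point 0 of \<open>X\<close>.\<close>
    have "(\<Prod>b\<in>B. inverse (signed coth 0 b)) = 0"
      using assms by (intro prod_zero bexI[of _ 0]) (auto simp: signed_def)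
    then have "T (Inl 0) = 0" by (simp add: Inl)
    moreover have "T (Inl (Suc b)) = z ^ k * (coth (Suc b) * (\<Prod>a\<in>B - {b}. signed coth b a / signed coth (Suc b) a))"
      if "b \<in> B" for b
    proof -
      have "X - {Suc b} = insert 0 (Suc ` (B - {b}))" by (auto simp: X_def)
      then have 1: "(\<Prod>y\<in>X - {Suc b}. signed coth (Suc b) y) = coth (Suc b) * (\<Prod>a\<in>B - {b}. signed coth b a)"
        using assms by (simp add: prod.reindex) (simp add: signed_def)
      have 2: "(\<Prod>a\<in>B. inverse (signed coth (Suc b) a)) = (\<Prod>a\<in>B - {b}. inverse (signed coth (Suc b) a))"
        using assms that by (subst prod.remove[of B b]) (auto simp: signed_def coth_1)
      show ?thesis
        unfolding Inl 1 2 by (simp add: divide_inverse prod.distrib mult.assoc)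
    qed
    ultimately show ?thesis
      using assms by (simp add: X_def sum.reindex sum_distrib_left)
  qed
  moreover have "(\<Sum>b\<in>B. T (Inr b)) =
    - (z ^ Suc k * (\<Sum>b\<in>B - {0}. inverse (coth b) * (\<Prod>a\<in>B - {b}. signed coth b a / signed coth (b - 1) a)))"
  proof -
    have "(\<Prod>x\<in>X. inverse (signed coth 0 x)) = 0"
      using X by (intro prod_zero bexI[of _ 0]) (auto simp: signed_def X_def)
    then have "T (Inr 0) = 0" by (simp add: Inr)
    moreover have "T (Inr b) = - (z ^ Suc k * (inverse (coth b) * (\<Prod>a\<in>B - {b}. signed coth b a / signed coth (b - 1) a)))"
      if "b \<in> B - {0}" for b
    proof -
      obtain c where c: "b = Suc c" using \<open>b \<in> B - {0}\<close> by (cases b) auto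
      have "X = insert 0 (insert (Suc b) (Suc ` (B - {b})))"
        using that by (auto simp: X_def)
      moreover have "(\<Prod>x\<in>Suc ` (B - {b}). inverse (signed coth b x)) = (\<Prod>a\<in>B - {b}. inverse (signed coth c a))"
        by (simp add: prod.reindex c)
      \<comment> \<open>The point \<open>Suc b\<close> gives \<open>- coth 1 = - 1\<close>, the
        source of the minus sign.\<close>
      moreover have "signed coth b 0 = coth b" "signed coth b (Suc b) = - 1"
        by (auto simp: signed_def coth_1 c)
      ultimately have "(\<Prod>x\<in>X. inverse (signed coth b x)) = - (inverse (coth b) * (\<Prod>a\<in>B - {b}. inverse (signed coth (b - 1) a)))"
        using assms by (simp add: c image_iff)
      then show ?thesis
        unfolding Inr by (simp add: divide_inverse prod.distrib)
    qed
    ultimately show ?thesis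
      using assms by (subst sum.remove[of B 0]) (simp_all add: sum_negf sum_distrib_left)
  qed
  ultimately have "z ^ k * (\<Sum>b\<in>B. coth (Suc b) * (\<Prod>a\<in>B - {b}. signed coth b a / signed coth (Suc b) a)) -
      z ^ k * (z * (\<Sum>b\<in>B - {0}. inverse (coth b) * (\<Prod>a\<in>B - {b}. signed coth b a / signed coth (b - 1) a))) = z ^ k * 1"
    by (simp add: mult_ac)
  then show ?thesis
    using z0 unfolding right_diff_distrib[symmetric] mult_cancel_left by (simp add: algebra_simps)
qed

end

section \<open>The recurrence\<close>

lemma beta_weight_mult: "beta_weight (\<lambda>h. \<phi> h * \<psi> h) B = beta_weight \<phi> B * beta_weight \<psi> B"
  by (simp add: beta_weight_def prod.distrib)

lemma partitions_0: "partitions 0 = {[]}"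
proof -
  have "l = []" if "l \<in> partitions 0" for l
    using that by (cases l) (auto simp: partitions_def)
  then show ?thesis by (auto simp: partitions_def)
qed

context generic_coth
begin

definition hook_sum :: "nat \<Rightarrow> 'a" where
  "hook_sum n = (\<Sum>l\<in>partitions n. \<Prod>x\<in>young_diagram l. rho (hook_length l x) z)"

lemma hook_sum_0: "hook_sum 0 = 1"
  by (simp add: hook_sum_def partitions_0 young_diagram_def)

lemma hook_sum_beta_sets:
  assumes "n \<le> k"
  shows "hook_sum n =
    (\<Sum>B\<in>beta_sets k n. beta_weight (\<lambda>h. inverse (of_nat h)) B * beta_weight coth B)"
proof -
  have "rho h z = inverse (of_nat h) * coth h" for h
    by (simp add: rho_eq coth_def)
  moreover have "rho h z \<noteq> 0" if "h > 0" for h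
    using that coth_nonzero[of h] by (simp add: rho_eq flip: coth_def)
  ultimately show ?thesis
    using sum_partitions_eq_sum_beta_sets[of "\<lambda>h. rho h z" n k] assms
    by (simp add: hook_sum_def flip: beta_weight_mult)
qed

lemma sum_raise_coth:
  assumes "finite B" "0 \<in> B"
  shows "(\<Sum>b\<in>addable B. beta_weight coth (raise b B)) =
    beta_weight coth B + z * (\<Sum>c\<in>removable B. beta_weight coth (lower c B))"
proof -
  have nz: "\<And>h. h > 0 \<Longrightarrow> coth h \<noteq> 0"
    by (rule coth_nonzero)
  show ?thesis
    using sum_raise[of coth B, OF nz assms(1)] sum_lower[of coth B, OF nz assms(1)] sum_signed_coth[OF assms]
    by (simp add: algebra_simps)
qed

text \<open>Deletions in \<open>H\<close> become additions in \<open>P\<close> by double counting;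
  these expand into deletions in \<open>P\<close>, which a second double counting turns into
  additions in \<open>H\<close>.\<close>

lemma hook_sum_Suc:
  "of_nat (Suc n) * hook_sum (Suc n) = hook_sum n + (if n = 0 then 0 else z * hook_sum (n - 1))"
proof -
  define H :: "nat set \<Rightarrow> 'a" where "H = beta_weight (\<lambda>h. inverse (of_nat h))"
  define P where "P = beta_weight coth"
  \<comment> \<open>\<open>Suc n\<close> rows hold every partition of \<open>Suc n\<close> and force
    0 into the beta-sets for sizes up to \<open>n\<close>, as both raising identities
    require.\<close>
  define k where "k = Suc n"
  have hs: "hook_sum m = (\<Sum>B\<in>beta_sets k m. H B * P B)" if "m \<le> k" for m
    using hook_sum_beta_sets[OF that] by (simp add: H_def P_def)
  have B: "finite B" "0 \<in> B" if "B \<in> beta_sets k m" "m \<le> n" for B m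
    using that zero_in_beta_set[of B k m] by (auto simp: k_def beta_sets_def)
  have "of_nat (Suc n) * hook_sum (Suc n) = (\<Sum>B\<in>beta_sets k (Suc n). of_nat (Suc n) * H B * P B)"
    by (simp add: hs k_def sum_distrib_left mult.assoc)
  also have "\<dots> = (\<Sum>B\<in>beta_sets k (Suc n). \<Sum>c\<in>removable B. H (lower c B) * P B)"
    unfolding H_def by (intro sum.cong refl) (simp only: sum_lower_inverse_hooks[symmetric] sum_distrib_right)
  also have "\<dots> = (\<Sum>B\<in>beta_sets k n. \<Sum>b\<in>addable B. H B * P (raise b B))"
    by (rule sum_removable_eq_sum_addable)
  also have "\<dots> = (\<Sum>B\<in>beta_sets k n. H B * P B + z * (\<Sum>c\<in>removable B. H B * P (lower c B)))"
  proof (intro sum.cong refl)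
    fix B assume "B \<in> beta_sets k n"
    then have "(\<Sum>b\<in>addable B. P (raise b B)) = P B + z * (\<Sum>c\<in>removable B. P (lower c B))"
      unfolding P_def by (intro sum_raise_coth B[of B n]) auto
    then show "(\<Sum>b\<in>addable B. H B * P (raise b B)) =
        H B * P B + z * (\<Sum>c\<in>removable B. H B * P (lower c B))"
      by (simp add: algebra_simps flip: sum_distrib_left)
  qed
  also have "\<dots> = hook_sum n + z * (\<Sum>B\<in>beta_sets k n. \<Sum>c\<in>removable B. H B * P (lower c B))"
    by (simp add: hs k_def sum.distrib sum_distrib_left)
  also have "(\<Sum>B\<in>beta_sets k n. \<Sum>c\<in>removable B. H B * P (lower c B)) = (if n = 0 then 0 else hook_sum (n - 1))"
  proof (cases n)
    case 0
    then show ?thesis by (simp add: removable_beta_sets_0)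
  next
    case (Suc m)
    have "(\<Sum>B\<in>beta_sets k (Suc m). \<Sum>c\<in>removable B. H B * P (lower c B)) =
      (\<Sum>B\<in>beta_sets k m. \<Sum>b\<in>addable B. H (raise b B) * P B)"
      by (rule sum_removable_eq_sum_addable)
    also have "\<dots> = (\<Sum>B\<in>beta_sets k m. H B * P B)"
    proof (intro sum.cong refl)
      fix B assume "B \<in> beta_sets k m"
      then have "(\<Sum>b\<in>addable B. H (raise b B)) = H B"
        unfolding H_def using Suc by (intro sum_raise_inverse_hooks B[of B m]) auto
      then show "(\<Sum>b\<in>addable B. H (raise b B) * P B) = H B * P B"
        by (simp flip: sum_distrib_right)
    qed
    finally show ?thesis
      using Suc by (simp add: hs k_def)
  qed
  finally show ?thesis by simp
qed

text \<open>The exponential solves \<open>E' = (1 + z t) E\<close> with constant coefficient 1,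
  which is the recurrence of \<open>hook_sum_Suc\<close> read on coefficients.\<close>

lemma hook_sum_eq_exp:
  "fps_exp 1 oo (fps_X + fps_const (z / 2) * fps_X ^ 2) = Abs_fps hook_sum"
proof -
  define g :: "'a fps" where "g = fps_X + fps_const (z / 2) * fps_X ^ 2"
  define E where "E = fps_exp 1 oo g"
  have g0: "fps_nth g 0 = 0"
    by (simp add: g_def)
  have "fps_deriv g = 1 + fps_const z * fps_X"
    by (simp add: g_def fps_deriv_power fps_eq_iff)
  then have "fps_deriv E = E + fps_const z * (fps_X * E)"
    using fps_compose_deriv[OF g0, of "fps_exp 1"] by (simp add: E_def algebra_simps)
  \<comment> \<open>The product with \<open>fps_X\<close> has constant coefficient 0, hence the case
    \<open>n = 0\<close>.\<close>
  then have E_Suc: "of_nat (Suc n) * fps_nth E (Suc n) =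
      fps_nth E n + (if n = 0 then 0 else z * fps_nth E (n - 1))" for n
    by (auto simp: fps_eq_iff mult.commute dest!: spec[of _ n])
  have E_0: "fps_nth E 0 = 1"
    by (simp add: E_def)
  have "fps_nth E n = hook_sum n" for n
  proof (induction n rule: less_induct)
    case (less n)
    show ?case
    proof (cases n)
      case 0
      then show ?thesis by (simp add: E_0 hook_sum_0)
    next
      case (Suc m)
      then have "of_nat (Suc m) * fps_nth E (Suc m) = of_nat (Suc m) * hook_sum (Suc m)"
        unfolding E_Suc hook_sum_Suc using less by simp
      then show ?thesis
        using Suc by (simp only: mult_cancel_left of_nat_eq_0_iff) simp
    qed
  qed
  then show ?thesis
    by (simp add: fps_eq_iff E_def g_def)
qed

end

section \<open>The indeterminate as a generic argument\<close>

text \<open>The sum is the image of a polynomial with nonzero value at 0, and polynomials embed into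
  their fractions.\<close>

lemma sum_indet_nonzero:
  assumes "c 0 \<noteq> 0"
  shows "(\<Sum>k\<le>n. of_nat (c k) * (indet :: 'a::field_char_0 poly fract) ^ k) \<noteq> 0"
proof -
  define \<iota> :: "'a poly \<Rightarrow> 'a poly fract" where "\<iota> p = Fraction_Field.Fract p 1" for p
  have add: "\<iota> p + \<iota> q = \<iota> (p + q)" and mult: "\<iota> p * \<iota> q = \<iota> (p * q)" for p q
    by (simp_all add: \<iota>_def)
  have 0: "0 = \<iota> 0" and 1: "1 = \<iota> 1"
    by (simp_all add: \<iota>_def Zero_fract_def One_fract_def)
  have pow: "\<iota> p ^ k = \<iota> (p ^ k)" for p k
    by (induction k) (simp_all add: 1 mult)
  have nat: "of_nat k = \<iota> (of_nat k)" for k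
    by (induction k) (simp_all add: 0 1 add)
  have sum: "(\<Sum>k\<in>A. \<iota> (h k)) = \<iota> (\<Sum>k\<in>A. h k)" if "finite A" for A :: "nat set" and h
    using that by (induction A) (simp_all add: 0 add)
  define p :: "'a poly" where "p = (\<Sum>k\<le>n. of_nat (c k) * [:0, 1:] ^ k)"
  have "(\<Sum>k\<le>n. of_nat (c k) * indet ^ k) = \<iota> p"
    by (simp add: indet_def p_def pow mult sum nat flip: \<iota>_def)
  moreover have "poly p 0 = of_nat (c 0)"
    unfolding p_def poly_sum by (subst sum.remove[of _ 0]) (auto simp: power_0_left poly_power)
  then have "p \<noteq> 0"
    using assms by auto
  then have "\<iota> p \<noteq> 0"
    by (simp add: \<iota>_def Zero_fract_def eq_fract)
  ultimately show ?thesis by simp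
qed

text \<open>Constant coefficients decide: 1 for the numerator and \<open>n\<close> for the
  denominator.\<close>

interpretation indet: generic_coth "indet :: 'a::field_char_0 poly fract"
proof
  show "(indet :: 'a poly fract) \<noteq> 0"
    by (simp add: indet_def Zero_fract_def eq_fract)
  show "(indet :: 'a poly fract) \<noteq> 1"
    by (simp add: indet_def One_fract_def eq_fract one_pCons)
  show "coth_num (indet :: 'a poly fract) n \<noteq> 0" for n
    unfolding coth_num_def by (rule sum_indet_nonzero) simp
  show "coth_den (indet :: 'a poly fract) n \<noteq> 0" if "n > 0" for n
    unfolding coth_den_def by (rule sum_indet_nonzero) (use that in simp)
qed

theorem theorem1p1:
  "fps_exp 1 oo (fps_X + fps_const ((indet :: 'a::field_char_0 poly fract) / 2) * fps_X ^ 2) =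
   Abs_fps (\<lambda>n. \<Sum>l\<in>partitions n. \<Prod>x\<in>young_diagram l. rho (hook_length l x) indet)"
  using indet.hook_sum_eq_exp unfolding indet.hook_sum_def .

end
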